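(* Let $\Gamma$ be a finite connected graph on $V=\{1,\dots,n\}$, $n\ge 2$, with symmetric weighted adjacency matrix $A=(a_{ij})$, let $\sigma\in[0,\infty)^n$ and $U=\mathrm{diag}(\sigma_1,\dots,\sigma_n)\ge 0$. Let $\lambda_1(U)\le\lambda_2(U)\le\dots\le\lambda_n(U)$ be the eigenvalues of $H_U=\mathrm{Id}-D^{-1/2}(A-U)D^{-1/2}$, and $\lambda_2(0)$ the second smallest eigenvalue of $H_0=\mathrm{Id}-D^{-1/2}AD^{-1/2}$. Then \[ \lambda_2(U)\le\lambda_2(0)+\mathcal{S}_U(\Gamma)\le 2h(\Gamma)+\mathcal{S}_U(\Gamma). \]
   Context: $A$ has nonnegative real entries ($a_{ii}$ loop weights); $\deg(j)=\sum_i a_{ij}>0$ and $D=\mathrm{diag}(\deg(1),\dots,\deg(n))$. The effective surface area is $\mathcal{S}_U(\Gamma)=\sum_{j=1}^n\sigma_j/\deg(j)$. The Cheeger constant is \[ h(\Gamma)=\min_{\emptyset\ne X\subsetneq V}\frac{E(X,V\setminus X)}{\min\{\mathrm{vol}(X),\mathrm{vol}(V\setminus X)\}}, \] with $E(X,V\setminus X)=\sum_{i\in X,\,j\in V\setminus X}a_{ij}$ and $\mathrm{vol}(X)=\sum_{j\in X}\deg(j)$. *)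

theory Defs
  imports
    "Jordan_Normal_Form.Char_Poly"
    "HOL-Computational_Algebra.Fundamental_Theorem_Algebra"
begin

text \<open>
  A weighted graph on \<open>n\<close> vertices is given by its \<open>n \<times> n\<close> weight matrix; the vertices are the
  matrix indices \<open>0, \<dots>, n - 1\<close>. Vertices \<open>i\<close> and \<open>j\<close> are adjacent iff their weight is positive.
\<close>

definition vertices :: "real mat \<Rightarrow> nat set" where
  "vertices A = {0..<dim_row A}"

definition adjacency :: "real mat \<Rightarrow> (nat \<times> nat) set" where
  "adjacency A = {(i, j). i \<in> vertices A \<and> j \<in> vertices A \<and> A $$ (i, j) > 0}"

definition connected_graph :: "real mat \<Rightarrow> bool" where
  "connected_graph A \<longleftrightarrow> (\<forall>i\<in>vertices A. \<forall>j\<in>vertices A. (i, j) \<in> (adjacency A)\<^sup>*)"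

definition deg :: "real mat \<Rightarrow> nat \<Rightarrow> real" where
  "deg A j = (\<Sum>i\<in>vertices A. A $$ (i, j))"

definition vol :: "real mat \<Rightarrow> nat set \<Rightarrow> real" where
  "vol A X = (\<Sum>j\<in>X. deg A j)"

definition edge_weight :: "real mat \<Rightarrow> nat set \<Rightarrow> nat set \<Rightarrow> real" where
  "edge_weight A X Y = (\<Sum>i\<in>X. \<Sum>j\<in>Y. A $$ (i, j))"

definition cheeger :: "real mat \<Rightarrow> real" where
  "cheeger A = Min {edge_weight A X (vertices A - X) / min (vol A X) (vol A (vertices A - X)) |X.
     X \<noteq> {} \<and> X \<subset> vertices A}"

definition surface_area :: "real mat \<Rightarrow> real vec \<Rightarrow> real" where
  "surface_area A \<sigma> = (\<Sum>j\<in>vertices A. \<sigma> $ j / deg A j)"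

text \<open>The matrix \<open>D\<^bsup>-1/2\<^esup>\<close> for \<open>D = diag(deg(1), \<dots>, deg(n))\<close>.\<close>

definition deg_inv_sqrt :: "real mat \<Rightarrow> real mat" where
  "deg_inv_sqrt A = mat_diag (dim_row A) (\<lambda>j. 1 / sqrt (deg A j))"

definition H_mat :: "real mat \<Rightarrow> real mat \<Rightarrow> real mat" where
  "H_mat A U = 1\<^sub>m (dim_row A) - deg_inv_sqrt A * (A - U) * deg_inv_sqrt A"

text \<open>
  The \<open>k\<close>-th smallest real eigenvalue (\<open>k \<ge> 1\<close>), counted with multiplicity. A symmetric real
  \<open>n \<times> n\<close> matrix has exactly \<open>n\<close> of them.
\<close>

definition nth_eigenvalue :: "nat \<Rightarrow> real mat \<Rightarrow> real" where
  "nth_eigenvalue k M = sorted_list_of_multiset (proots (char_poly M)) ! (k - 1)"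

end

theory Submission
  imports Defs
begin

text \<open>
  Both inequalities follow from the Courant--Fischer principle: \<open>\<lambda>\<^sub>2 \<le> c\<close> iff the quadratic form is
  at most \<open>c \<bar>z\<bar>\<^sup>2\<close> on some plane. The form of \<open>H\<^sub>U\<close> exceeds that of \<open>H\<^sub>0\<close> by
  \<open>\<Sum>\<^sub>j \<sigma>\<^sub>j / deg(j) z\<^sub>j\<^sup>2 \<le> S\<^sub>U \<bar>z\<bar>\<^sup>2\<close>, so a plane that is optimal for \<open>H\<^sub>0\<close> serves \<open>H\<^sub>U\<close> with
  \<open>c = \<lambda>\<^sub>2(0) + S\<^sub>U\<close>. For the Cheeger bound take the plane of the vectors \<open>D\<^bsup>1/2\<^esup> f\<close> with \<open>f\<close> equal to
  \<open>a\<close> on \<open>X\<close> and to \<open>b\<close> off \<open>X\<close>: there the form of \<open>H\<^sub>0\<close> is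
  \<open>(a - b)\<^sup>2 E(X, V - X) \<le> 2 (a\<^sup>2 + b\<^sup>2) E(X, V - X)\<close>, and the squared norm is
  \<open>a\<^sup>2 vol(X) + b\<^sup>2 vol(V - X)\<close>.
\<close>

section \<open>Orthogonal diagonalization of real symmetric matrices\<close>

lemma eigenvalue_of_real_symmetric_real:
  fixes M :: "real mat"
  assumes M: "M \<in> carrier_mat n n" and sym: "transpose_mat M = M"
    and ev: "eigenvalue (map_mat complex_of_real M) a"
  shows "a \<in> \<real>"
proof -
  have symij: "M $$ (j, i) = M $$ (i, j)" if "i < n" "j < n" for i j
    using that M sym by (metis carrier_matD index_transpose_mat(1))
  from ev M obtain v where v: "v \<in> carrier_vec n" "v \<noteq> 0\<^sub>v n"
    and eq: "map_mat complex_of_real M *\<^sub>v v = a \<cdot>\<^sub>v v"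
    unfolding eigenvalue_def eigenvector_def by auto
  have row: "(\<Sum>j<n. of_real (M $$ (i, j)) * v $ j) = a * v $ i" if "i < n" for i
    using arg_cong[OF eq, of "\<lambda>w. w $ i"] that M v
    by (simp add: scalar_prod_def atLeast0LessThan)
  define q where "q = (\<Sum>i<n. \<Sum>j<n. cnj (v $ i) * of_real (M $$ (i, j)) * v $ j)"
  define s where "s = (\<Sum>i<n. (cmod (v $ i))\<^sup>2)"
  have q: "q = a * of_real s"
  proof -
    have "q = (\<Sum>i<n. cnj (v $ i) * (a * v $ i))"
      unfolding q_def by (intro sum.cong refl) (simp add: row[symmetric] sum_distrib_left mult.assoc)
    also have "\<dots> = a * of_real s"
      unfolding s_def of_real_sum sum_distrib_left
      by (intro sum.cong refl) (simp add: complex_norm_square mult.left_commute mult.commute del: of_real_power)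
    finally show ?thesis .
  qed
  have "cnj q = (\<Sum>i<n. \<Sum>j<n. cnj (v $ j) * of_real (M $$ (j, i)) * v $ i)"
    unfolding q_def cnj_sum by (intro sum.cong refl) (simp add: symij)
  also have "\<dots> = q"
    unfolding q_def by (rule sum.swap)
  finally have "q \<in> \<real>" by (simp add: Reals_cnj_iff)
  moreover have "s \<noteq> 0"
  proof
    assume "s = 0"
    then have "\<forall>i<n. v $ i = 0"
      unfolding s_def by (subst (asm) sum_nonneg_eq_0_iff) auto
    with v show False by (auto intro: eq_vecI)
  qed
  ultimately show ?thesis
    using q by (metis Reals_divide Reals_of_real nonzero_mult_div_cancel_right of_real_eq_0_iff)
qed

text \<open>The polynomial splits over the complex numbers and all its roots are real eigenvalues.
  The factorization therefore lies in the image of the embedding of real polynomials and descends by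
  injectivity.\<close>

lemma char_poly_symmetric_splits:
  fixes M :: "real mat"
  assumes M: "M \<in> carrier_mat n n" and sym: "transpose_mat M = M"
  shows "\<exists>es. char_poly M = (\<Prod>e\<leftarrow>es. [:- e, 1:]) \<and> length es = n"
proof -
  let ?M = "map_mat complex_of_real M"
  have cM: "?M \<in> carrier_mat n n" using M by simp
  from char_poly_factorized[OF cM] obtain as
    where as: "char_poly ?M = (\<Prod>a\<leftarrow>as. [:- a, 1:])" and len: "length as = n" by blast
  have real: "a \<in> \<real>" if "a \<in> set as" for a
  proof -
    have "poly (char_poly ?M) a = 0"
      unfolding as using that by (auto simp: poly_prod_list prod_list_zero_iff)
    then show ?thesis
      using eigenvalue_of_real_symmetric_real[OF M sym] eigenvalue_root_char_poly[OF cM] by blast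
  qed
  interpret p: map_poly_inj_comm_ring_hom complex_of_real ..
  have "map_poly of_real (char_poly M) = (\<Prod>a\<leftarrow>as. [:- a, 1:])"
    using of_real_hom.char_poly_hom[OF M] as by metis
  also have "\<dots> = (\<Prod>a\<leftarrow>map Re as. map_poly of_real [:- a, 1:])"
    unfolding map_map by (intro arg_cong[of _ _ prod_list] map_cong refl) (simp add: real)
  also have "\<dots> = map_poly of_real (\<Prod>a\<leftarrow>map Re as. [:- a, 1:])"
    by (simp add: p.hom_prod_list comp_def)
  finally have "char_poly M = (\<Prod>a\<leftarrow>map Re as. [:- a, 1:])"
    by simp
  with len show ?thesis by (intro exI[of _ "map Re as"]) simp
qed

text \<open>Connects \<open>nth_eigenvalue\<close>, which is built from \<open>proots\<close>, with
  an explicit list of linear factors.\<close>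

lemma proots_prod_linear_factors:
  "proots (\<Prod>e\<leftarrow>es. [:- e, 1:]) = mset (es :: 'a :: field list)"
proof (induction es)
  case (Cons e es)
  have "(\<Prod>e\<leftarrow>es. [:- e, 1:]) \<noteq> (0 :: 'a poly)" by (auto simp: prod_list_zero_iff)
  then have "proots ([:- e, 1:] * (\<Prod>e\<leftarrow>es. [:- e, 1:])) = add_mset e (mset es)"
    using Cons by (subst proots_mult) simp_all
  then show ?case by (simp only: list.map prod_list.Cons mset.simps)
qed simp

section \<open>Householder reflections in the hyperplane orthogonal to a vector\<close>

text \<open>For \<open>u = 0\<close> this is the identity matrix, because \<open>2 / 0 = 0\<close>.\<close>

definition householder :: "nat \<Rightarrow> real vec \<Rightarrow> real mat" where
  "householder n u = mat n n (\<lambda>(i, j). (if i = j then 1 else 0) - 2 / (u \<bullet> u) * u $ i * u $ j)"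

lemma householder_carrier [simp]: "householder n u \<in> carrier_mat n n"
  by (simp add: householder_def)

lemma transpose_householder: "transpose_mat (householder n u) = householder n u"
  by (rule eq_matI) (auto simp: householder_def)

lemma householder_mult_vec:
  assumes "u \<in> carrier_vec n" "w \<in> carrier_vec n"
  shows "householder n u *\<^sub>v w = w - (2 * (u \<bullet> w) / (u \<bullet> u)) \<cdot>\<^sub>v u"
proof (rule eq_vecI)
  fix i assume i: "i < dim_vec (w - (2 * (u \<bullet> w) / (u \<bullet> u)) \<cdot>\<^sub>v u)"
  then have "i < n" using assms by simp
  let ?c = "2 / (u \<bullet> u)"
  have "(householder n u *\<^sub>v w) $ i
      = (\<Sum>j<n. (if i = j then w $ j else 0) - ?c * u $ i * (u $ j * w $ j))"
    using assms \<open>i < n\<close>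
    by (auto simp: householder_def scalar_prod_def atLeast0LessThan algebra_simps intro!: sum.cong)
  also have "\<dots> = w $ i - ?c * u $ i * (u \<bullet> w)"
    using assms \<open>i < n\<close>
    by (subst sum_subtractf, subst sum_distrib_left[symmetric])
      (simp add: scalar_prod_def atLeast0LessThan)
  finally show "(householder n u *\<^sub>v w) $ i = (w - (2 * (u \<bullet> w) / (u \<bullet> u)) \<cdot>\<^sub>v u) $ i"
    using assms \<open>i < n\<close> by simp
qed (use assms in \<open>simp add: householder_def\<close>)

lemma householder_involution:
  assumes u: "u \<in> carrier_vec n"
  shows "householder n u * householder n u = 1\<^sub>m n"
proof (rule eq_matI)
  fix i j assume "i < dim_row (1\<^sub>m n :: real mat)" "j < dim_col (1\<^sub>m n :: real mat)"
  then have ij: "i < n" "j < n" by auto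
  define c where "c = 2 / (u \<bullet> u)"
  \<comment> \<open>This also covers \<open>u \<bullet> u = 0\<close>, where \<open>c = 0\<close> by
    the convention for division by zero. It is the identity that cancels the rank-one terms of the
    product.\<close>
  have c: "c * c * (u \<bullet> u) = 2 * c" by (simp add: c_def)
  let ?\<delta> = "\<lambda>i k. if i = k then 1 else 0 :: real"
  have "(householder n u * householder n u) $$ (i, j)
      = (\<Sum>k<n. (?\<delta> i k - c * u $ i * u $ k) * (?\<delta> k j - c * u $ k * u $ j))"
    using ij by (simp add: householder_def scalar_prod_def atLeast0LessThan c_def)
  also have "\<dots> = (\<Sum>k<n. (if i = k then ?\<delta> k j - c * u $ k * u $ j else 0)
      - (if k = j then c * u $ i * u $ k else 0) + c * c * u $ i * u $ j * (u $ k * u $ k))"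
    by (intro sum.cong refl) (auto simp: algebra_simps)
  also have "\<dots> = ?\<delta> i j - c * u $ i * u $ j - c * u $ i * u $ j + c * c * u $ i * u $ j * (u \<bullet> u)"
    using ij u by (simp add: sum.distrib sum_subtractf sum_distrib_left[symmetric]
        scalar_prod_def atLeast0LessThan)
  also have "\<dots> = ?\<delta> i j + (c * c * (u \<bullet> u) - 2 * c) * u $ i * u $ j"
    by (simp add: algebra_simps)
  finally show "(householder n u * householder n u) $$ (i, j) = 1\<^sub>m n $$ (i, j)"
    using ij c by simp
qed (simp_all add: householder_def)

text \<open>Two distinct vectors of equal length are exchanged by the reflection in the hyperplane
  orthogonal to their difference; if they coincide, the reflection degenerates to the identity. In
  the diagonalization this carries a basis vector to an eigenvector.\<close>

lemma householder_maps_unit_vec: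
  assumes v: "v \<in> carrier_vec n" and norm: "v \<bullet> v = 1" and k: "k < n"
  shows "householder n (v - unit_vec n k) *\<^sub>v unit_vec n k = v"
proof -
  let ?e = "unit_vec n k :: real vec"
  let ?u = "v - ?e"
  have u: "?u \<in> carrier_vec n" and e: "?e \<in> carrier_vec n" using v by auto
  have ve: "v \<bullet> ?e = v $ k" using v k by simp
  have ue: "?u \<bullet> ?e = v $ k - 1"
    using v k by (simp add: minus_scalar_prod_distrib[OF v e e])
  have uv: "?u \<bullet> v = 1 - v $ k"
    using v k norm by (simp add: minus_scalar_prod_distrib[OF v e v])
  have uu: "?u \<bullet> ?u = 2 * (1 - v $ k)"
    using v by (simp add: scalar_prod_minus_distrib[OF u v e] ue uv)
  show ?thesis
  proof (cases "?u \<bullet> ?u = 0")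
    case True
    then have "(\<Sum>i<n. (?u $ i)\<^sup>2) = 0"
      using v by (simp add: scalar_prod_def atLeast0LessThan power2_eq_square)
    then have "\<forall>i<n. ?u $ i = 0"
      by (subst (asm) sum_nonneg_eq_0_iff) auto
    then have "\<forall>i<n. v $ i = ?e $ i" using v by auto
    then have "v = ?e" using v by (intro eq_vecI) auto
    with True show ?thesis
      using v by (subst householder_mult_vec[OF u e]) (auto intro!: eq_vecI)
  next
    case False
    then have "2 * (?u \<bullet> ?e) / (?u \<bullet> ?u) = - 1"
      unfolding ue uu by (simp add: field_simps)
    then show ?thesis
      using v by (subst householder_mult_vec[OF u e]) (auto intro!: eq_vecI)
  qed
qed

section \<open>Spectral theorem by deflation\<close>

text \<open>Induction on the list of roots: a reflection \<open>H\<close> moves a unit eigenvector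
  for the first root to the first basis vector, and \<open>H * M * H\<close> then splits into a 1 by
  1 block and a symmetric block whose characteristic polynomial has the remaining roots. The
  diagonal follows the order of \<open>es\<close>, so any ordering of the eigenvalues can be
  realized.\<close>

theorem symmetric_orthogonal_diagonalization:
  fixes M :: "real mat"
  assumes "M \<in> carrier_mat n n" and "transpose_mat M = M"
    and "char_poly M = (\<Prod>e\<leftarrow>es. [:- e, 1:])"
  shows "\<exists>P. similar_mat_wit M (mat_diag n (nth es)) P (transpose_mat P)"
  using assms
proof (induction es arbitrary: n M)
  case Nil
  then have "n = 0" using degree_monic_char_poly[OF Nil(1)] by simp
  with Nil show ?case
    by (intro exI[of _ "1\<^sub>m n"]) (auto intro!: similar_mat_witI)
next
  case (Cons e es)
  note M = Cons.prems(1) and sym = Cons.prems(2)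
  have "poly (char_poly M) e = 0" unfolding Cons.prems(3) by simp
  then obtain w where w: "w \<in> carrier_vec n" "w \<noteq> 0\<^sub>v n" and Mw: "M *\<^sub>v w = e \<cdot>\<^sub>v w"
    using eigenvalue_root_char_poly[OF M] M unfolding eigenvalue_def eigenvector_def by auto
  have "n \<noteq> 0" using w by (auto intro: eq_vecI)
  then obtain m where n: "n = 1 + m" by (metis Suc_pred' bot_nat_0.not_eq_extremum plus_1_eq_Suc)
  define v where "v = (1 / sqrt (w \<bullet> w)) \<cdot>\<^sub>v w"
  have ww: "w \<bullet> w = (\<Sum>i<n. (w $ i)\<^sup>2)"
    using w by (simp add: scalar_prod_def atLeast0LessThan power2_eq_square)
  have "w \<bullet> w \<noteq> 0"
  proof
    assume "w \<bullet> w = 0"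
    then have "\<forall>i<n. w $ i = 0" unfolding ww by (subst (asm) sum_nonneg_eq_0_iff) auto
    with w show False by (auto intro: eq_vecI)
  qed
  moreover have "w \<bullet> w \<ge> 0" unfolding ww by (intro sum_nonneg) auto
  ultimately have v1: "v \<bullet> v = 1" and v: "v \<in> carrier_vec n"
    using w by (auto simp: v_def)
  have Mv: "M *\<^sub>v v = e \<cdot>\<^sub>v v"
    unfolding v_def using M w Mw by (simp add: mult_mat_vec smult_smult_assoc mult.commute)
  let ?e = "unit_vec n 0 :: real vec"
  define H where "H = householder n (v - ?e)"
  have u: "v - ?e \<in> carrier_vec n" using v by simp
  have H: "H \<in> carrier_mat n n" and HT: "transpose_mat H = H" and HH: "H * H = 1\<^sub>m n"
    and He: "H *\<^sub>v ?e = v"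
    using householder_involution[OF u] transpose_householder householder_maps_unit_vec[OF v v1]
      \<open>n \<noteq> 0\<close> by (auto simp: H_def)
  define N where "N = H * M * H"
  have N: "N \<in> carrier_mat n n" using H M by (simp add: N_def)
  have NT: "transpose_mat N = N"
    unfolding N_def using H M HT sym
    by (simp add: transpose_mult[of _ n n _ n] assoc_mult_mat[of _ n n _ n _ n])
  have NM: "similar_mat_wit N M H H"
    by (rule similar_mat_witI[of _ _ n]) (use H M N HH in \<open>auto simp: N_def\<close>)
  have Ne: "N *\<^sub>v ?e = e \<cdot>\<^sub>v ?e"
  proof -
    have "N *\<^sub>v ?e = H *\<^sub>v (M *\<^sub>v (H *\<^sub>v ?e))"
      unfolding N_def using H M by (simp add: assoc_mult_mat_vec[of _ n n _ n])
    also have "\<dots> = e \<cdot>\<^sub>v (H *\<^sub>v (H *\<^sub>v ?e))"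
      unfolding He Mv using H v by (simp add: mult_mat_vec)
    also have "\<dots> = e \<cdot>\<^sub>v ?e"
      using H HH by (simp add: assoc_mult_mat_vec[of _ n n _ n, symmetric])
    finally show ?thesis .
  qed
  \<comment> \<open>The eigenvector equation at the first basis vector fixes the first column of
    \<open>N\<close>; symmetry then fixes the first row, which yields the block form.\<close>
  have col: "N $$ (i, 0) = (if i = 0 then e else 0)" if "i < n" for i
    using arg_cong[OF Ne, of "\<lambda>x. x $ i"] that N \<open>n \<noteq> 0\<close> by simp
  have row: "N $$ (0, i) = (if i = 0 then e else 0)" if "i < n" for i
    using col[OF that] NT N that \<open>n \<noteq> 0\<close>
    by (metis carrier_matD bot_nat_0.not_eq_extremum index_transpose_mat(1))
  define N' where "N' = mat m m (\<lambda>(i, j). N $$ (Suc i, Suc j))"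
  let ?E = "mat 1 1 (\<lambda>_. e)"
  have N': "N' \<in> carrier_mat m m" by (simp add: N'_def)
  have E: "?E \<in> carrier_mat 1 1" by simp
  have N_block: "N = four_block_mat ?E (0\<^sub>m 1 m) (0\<^sub>m m 1) N'"
    using N n by (intro eq_matI) (auto simp: N'_def col row)
  have "transpose_mat N' = N'"
    using NT N n
    by (intro eq_matI)
      (auto simp: N'_def, metis Suc_less_eq carrier_matD index_transpose_mat(1) plus_1_eq_Suc)
  moreover have "char_poly N' = (\<Prod>e\<leftarrow>es. [:- e, 1:])"
  proof -
    have "char_poly ?E * char_poly N' = char_poly N"
      unfolding N_block by (rule char_poly_four_block_zeros_col[symmetric, OF E _ N']) simp
    also have "\<dots> = char_poly M"
      using NM by (intro char_poly_similar) (auto simp: similar_mat_def)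
    also have "\<dots> = [:- e, 1:] * (\<Prod>e\<leftarrow>es. [:- e, 1:])" unfolding Cons.prems(3) by simp
    also have "char_poly ?E = [:- e, 1:]"
      by (simp add: char_poly_defs det_def sign_def)
    finally show ?thesis
      by (metis mult_cancel_left pCons_eq_0_iff zero_neq_one)
  qed
  ultimately obtain P where P: "similar_mat_wit N' (mat_diag m (nth es)) P (transpose_mat P)"
    using Cons.IH[OF N'] by blast
  have Pc: "P \<in> carrier_mat m m" using similar_mat_witD2[OF N' P] by simp
  \<comment> \<open>\<open>R\<close> borders the orthogonal matrix of the smaller block by a 1. The
    final change of basis is \<open>H * R\<close>; because \<open>H\<close> is symmetric, the
    inverse \<open>transpose_mat R * H\<close> is again its transpose.\<close>
  define R where "R = four_block_mat (1\<^sub>m 1) (0\<^sub>m 1 m) (0\<^sub>m m 1) P"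
  have R: "R \<in> carrier_mat n n" unfolding R_def n by (rule four_block_carrier_mat[OF one_carrier_mat Pc])
  have "similar_mat_wit N (four_block_mat ?E (0\<^sub>m 1 m) (0\<^sub>m m 1) (mat_diag m (nth es)))
      R (four_block_mat (1\<^sub>m 1) (0\<^sub>m 1 m) (0\<^sub>m m 1) (transpose_mat P))"
    unfolding N_block R_def
    by (rule similar_mat_wit_four_block[OF similar_mat_wit_refl[OF E] P _ _ E N']) (use Pc in auto)
  also have "four_block_mat ?E (0\<^sub>m 1 m) (0\<^sub>m m 1) (mat_diag m (nth es)) = mat_diag n (nth (e # es))"
    unfolding n by (intro eq_matI) (auto simp: mat_diag_def nth_Cons')
  also have "four_block_mat (1\<^sub>m 1) (0\<^sub>m 1 m) (0\<^sub>m m 1) (transpose_mat P) = transpose_mat R"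
    unfolding R_def using Pc by (subst transpose_four_block_mat[of _ 1 1 _ m _ m]) auto
  finally have "similar_mat_wit M (mat_diag n (nth (e # es))) (H * R) (transpose_mat R * H)"
    by (rule similar_mat_wit_trans[OF similar_mat_wit_sym[OF NM]])
  moreover have "transpose_mat R * H = transpose_mat (H * R)"
    using H R HT by (simp add: transpose_mult[of _ n n _ n])
  ultimately show ?case by metis
qed

text \<open>Permuting the linear factors leaves their product unchanged, so the roots may be sorted
  before diagonalizing. The diagonal positions then agree with the ranks used by
  \<open>nth_eigenvalue\<close>.\<close>

corollary symmetric_sorted_diagonalization:
  fixes M :: "real mat"
  assumes M: "M \<in> carrier_mat n n" and sym: "transpose_mat M = M"
  obtains es P where "sorted es" "length es = n"
    "similar_mat_wit M (mat_diag n (nth es)) P (transpose_mat P)"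
    "\<And>k. nth_eigenvalue k M = es ! (k - 1)"
proof -
  obtain es where es: "char_poly M = (\<Prod>e\<leftarrow>es. [:- e, 1:])" and len: "length es = n"
    using char_poly_symmetric_splits[OF M sym] by blast
  have "mset (map (\<lambda>e. [:- e, 1:]) (sort es)) = mset (map (\<lambda>e. [:- e, 1:]) es)" by simp
  then have sorted_es: "char_poly M = (\<Prod>e\<leftarrow>sort es. [:- e, 1:])"
    unfolding es by (metis prod_mset_prod_list)
  obtain P where "similar_mat_wit M (mat_diag n (nth (sort es))) P (transpose_mat P)"
    using symmetric_orthogonal_diagonalization[OF M sym sorted_es] by blast
  moreover have "nth_eigenvalue k M = sort es ! (k - 1)" for k
    unfolding nth_eigenvalue_def es proots_prod_linear_factors by (simp add: sorted_list_of_multiset_mset)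
  ultimately show thesis using that[of "sort es" P] len by simp
qed

text \<open>In the coordinates \<open>transpose_mat P *\<^sub>v z\<close> the form is diagonal, and
  the norm is preserved because \<open>P\<close> is orthogonal.\<close>

lemma orthogonal_diagonalization_quadratic_form:
  fixes M :: "real mat"
  assumes sim: "similar_mat_wit M (mat_diag n l) P (transpose_mat P)"
    and M: "M \<in> carrier_mat n n" and z: "z \<in> carrier_vec n"
  shows "z \<bullet> (M *\<^sub>v z) = (\<Sum>i<n. l i * ((transpose_mat P *\<^sub>v z) $ i)\<^sup>2)"
    and "z \<bullet> z = (\<Sum>i<n. ((transpose_mat P *\<^sub>v z) $ i)\<^sup>2)"
proof -
  note MP = similar_mat_witD2(3)[OF M sim] and PP = similar_mat_witD2(1)[OF M sim]
    and P = similar_mat_witD2(6)[OF M sim] and PT = similar_mat_witD2(7)[OF M sim]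
  define y where "y = transpose_mat P *\<^sub>v z"
  have y: "y \<in> carrier_vec n" using PT z by (simp add: y_def)
  have D: "mat_diag n l *\<^sub>v y = vec n (\<lambda>i. l i * y $ i)"
    using y by (intro eq_vecI)
      (auto simp: mat_diag_def scalar_prod_def if_distrib[of "\<lambda>x. x * _"] cong: if_cong)
  have Dc: "mat_diag n l \<in> carrier_mat n n" by simp
  have "M *\<^sub>v z = P *\<^sub>v (mat_diag n l *\<^sub>v y)"
    using assoc_mult_mat_vec[OF mult_carrier_mat[OF P Dc] PT z] assoc_mult_mat_vec[OF P Dc y]
    by (metis MP y_def)
  then have "z \<bullet> (M *\<^sub>v z) = y \<bullet> (mat_diag n l *\<^sub>v y)"
    unfolding y_def using transpose_vec_mult_scalar[OF P _ z] y D by (simp add: y_def)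
  also have "\<dots> = (\<Sum>i<n. l i * (y $ i)\<^sup>2)"
    unfolding D by (simp add: scalar_prod_def atLeast0LessThan power2_eq_square algebra_simps)
  finally show "z \<bullet> (M *\<^sub>v z) = (\<Sum>i<n. l i * ((transpose_mat P *\<^sub>v z) $ i)\<^sup>2)"
    by (simp add: y_def)
  have "P *\<^sub>v y = z"
    unfolding y_def using P PT PP z by (simp add: assoc_mult_mat_vec[of _ n n _ n, symmetric])
  then have "z \<bullet> z = y \<bullet> y"
    using transpose_vec_mult_scalar[OF P y z] by (simp add: y_def)
  also have "\<dots> = (\<Sum>i<n. (y $ i)\<^sup>2)"
    using y by (simp add: scalar_prod_def atLeast0LessThan power2_eq_square)
  finally show "z \<bullet> z = (\<Sum>i<n. ((transpose_mat P *\<^sub>v z) $ i)\<^sup>2)"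
    by (simp only: y_def)
qed

section \<open>The second eigenvalue\<close>

text \<open>Forward, the plane is spanned by eigenvectors of the two smallest eigenvalues. Backward,
  any plane meets the orthogonal complement of the first eigenvector in a nonzero vector, and there
  the form is at least the second eigenvalue times the squared norm.\<close>

theorem second_eigenvalue_le_iff:
  fixes M :: "real mat"
  assumes M: "M \<in> carrier_mat n n" and sym: "transpose_mat M = M" and n: "n \<ge> 2"
  shows "nth_eigenvalue 2 M \<le> c \<longleftrightarrow>
    (\<exists>x\<in>carrier_vec n. \<exists>y\<in>carrier_vec n.
      (\<forall>a b. a \<cdot>\<^sub>v x + b \<cdot>\<^sub>v y = 0\<^sub>v n \<longrightarrow> a = 0 \<and> b = 0) \<and>
      (\<forall>a b. let z = a \<cdot>\<^sub>v x + b \<cdot>\<^sub>v y in z \<bullet> (M *\<^sub>v z) \<le> c * (z \<bullet> z)))"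
    (is "_ \<longleftrightarrow> ?span")
proof -
  obtain es P where sorted: "sorted es" and len: "length es = n"
    and sim: "similar_mat_wit M (mat_diag n (nth es)) P (transpose_mat P)"
    \<comment> \<open>Ranks start at 1 and list positions at 0, so the second eigenvalue sits at
      index 1.\<close>
    and ev: "nth_eigenvalue 2 M = es ! 1"
    using symmetric_sorted_diagonalization[OF M sym]
    by (metis diff_Suc_1 numeral_2_eq_2 One_nat_def)
  from similar_mat_witD2[OF M sim] have P: "P \<in> carrier_mat n n"
    and PT: "transpose_mat P \<in> carrier_mat n n" and PP: "transpose_mat P * P = 1\<^sub>m n" by auto
  note form = orthogonal_diagonalization_quadratic_form[OF sim M]
  show ?thesis
  proof
    assume "nth_eigenvalue 2 M \<le> c"
    then have c: "es ! 1 \<le> c" by (simp add: ev)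
    have le: "es ! 0 \<le> es ! 1" using sorted len n by (intro sorted_nth_mono) auto
    let ?e = "unit_vec n :: nat \<Rightarrow> real vec"
    \<comment> \<open>The columns 0 and 1 of \<open>P\<close> are eigenvectors for
      \<open>es ! 0\<close> and \<open>es ! 1\<close>; in the coordinates of \<open>P\<close> such a
      combination is \<open>(a, b, 0, ..., 0)\<close>.\<close>
    let ?z = "\<lambda>a b. a \<cdot>\<^sub>v (P *\<^sub>v ?e 0) + b \<cdot>\<^sub>v (P *\<^sub>v ?e 1)"
    have z: "?z a b \<in> carrier_vec n" for a b using P by simp
    have y: "(transpose_mat P *\<^sub>v ?z a b) $ i = (if i = 0 then a else if i = 1 then b else 0)"
      if "i < n" for a b i
    proof -
      have "transpose_mat P *\<^sub>v ?z a b = a \<cdot>\<^sub>v ?e 0 + b \<cdot>\<^sub>v ?e 1"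
        using P PT PP
        by (simp add: mult_add_distrib_mat_vec[of _ n n] mult_mat_vec[of _ n n]
            assoc_mult_mat_vec[of _ n n _ n, symmetric])
      then show ?thesis using that n by (auto simp: unit_vec_def)
    qed
    have split: "{..<n} = {0, 1} \<union> {2..<n}" using n by auto
    \<comment> \<open>The weights \<open>l\<close> are kept general: \<open>l = 1\<close> gives the
      squared norm and \<open>l = nth es\<close> gives the form.\<close>
    have sum: "(\<Sum>i<n. l i * ((transpose_mat P *\<^sub>v ?z a b) $ i)\<^sup>2) = l 0 * a\<^sup>2 + l 1 * b\<^sup>2"
      for a b and l :: "nat \<Rightarrow> real"
    proof -
      have "(\<Sum>i<n. l i * ((transpose_mat P *\<^sub>v ?z a b) $ i)\<^sup>2)
          = (\<Sum>i<n. l i * (if i = 0 then a else if i = 1 then b else 0)\<^sup>2)"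
        by (intro sum.cong refl) (simp only: y lessThan_iff)
      also have "\<dots> = l 0 * a\<^sup>2 + l 1 * b\<^sup>2"
        unfolding split by (subst sum.union_disjoint) auto
      finally show ?thesis .
    qed
    show ?span
    proof (intro bexI conjI allI impI)
      fix a b assume "?z a b = 0\<^sub>v n"
      then have "transpose_mat P *\<^sub>v ?z a b = 0\<^sub>v n"
        by (metis PT eq_vecI dim_mult_mat_vec carrier_matD index_zero_vec index_mult_mat_vec
            scalar_prod_right_zero row_carrier_vec)
      then show "a = 0" "b = 0" using y[of 0 a b] y[of 1 a b] n by auto
    next
      fix a b
      have zz: "?z a b \<bullet> ?z a b = a\<^sup>2 + b\<^sup>2"
        using form(2)[OF z[of a b]] sum[of "\<lambda>_. 1" a b] by simp
      have "?z a b \<bullet> (M *\<^sub>v ?z a b) = es ! 0 * a\<^sup>2 + es ! 1 * b\<^sup>2"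
        using form(1)[OF z[of a b]] sum[of "nth es" a b] by simp
      also have "\<dots> \<le> c * a\<^sup>2 + c * b\<^sup>2"
        using le c by (intro add_mono mult_right_mono) auto
      finally show "let z = ?z a b in z \<bullet> (M *\<^sub>v z) \<le> c * (z \<bullet> z)"
        unfolding Let_def zz by (simp add: algebra_simps)
    qed (use P in auto)
  next
    assume ?span
    then obtain x y where x: "x \<in> carrier_vec n" and y: "y \<in> carrier_vec n"
      and indep: "\<And>a b. a \<cdot>\<^sub>v x + b \<cdot>\<^sub>v y = 0\<^sub>v n \<Longrightarrow> a = 0 \<and> b = 0"
      and le: "\<And>a b z. z = a \<cdot>\<^sub>v x + b \<cdot>\<^sub>v y \<Longrightarrow> z \<bullet> (M *\<^sub>v z) \<le> c * (z \<bullet> z)"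
      by (auto simp: Let_def)
    \<comment> \<open>Some nonzero vector of the plane is orthogonal to the first eigenvector.\<close>
    let ?p = "(transpose_mat P *\<^sub>v x) $ 0" and ?q = "(transpose_mat P *\<^sub>v y) $ 0"
    obtain a b where ab: "a * ?p + b * ?q = 0" and nz: "a \<noteq> 0 \<or> b \<noteq> 0"
    proof (cases "?p = 0 \<and> ?q = 0")
      case True
      then show thesis using that[of 1 0] by simp
    next
      case False
      then show thesis using that[of ?q "- ?p"] by auto
    qed
    define z where "z = a \<cdot>\<^sub>v x + b \<cdot>\<^sub>v y"
    have z: "z \<in> carrier_vec n" using x y by (simp add: z_def)
    define w where "w = transpose_mat P *\<^sub>v z"
    have "w = a \<cdot>\<^sub>v (transpose_mat P *\<^sub>v x) + b \<cdot>\<^sub>v (transpose_mat P *\<^sub>v y)"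
      unfolding w_def z_def using PT x y
      by (simp add: mult_add_distrib_mat_vec[of _ n n] mult_mat_vec[of _ n n])
    then have w0: "w $ 0 = 0" using ab PT n by simp
    have "z \<noteq> 0\<^sub>v n" using indep[of a b] nz z_def by auto
    then obtain i where i: "i < n" "z $ i \<noteq> 0" using z by (metis carrier_vecD eq_vecI index_zero_vec)
    have "0 < (z $ i)\<^sup>2" using i by simp
    also have "\<dots> \<le> (\<Sum>i<n. (z $ i)\<^sup>2)" using i by (intro member_le_sum) auto
    finally have zz: "z \<bullet> z > 0"
      using z by (simp add: scalar_prod_def atLeast0LessThan power2_eq_square)
    have "es ! 1 * (z \<bullet> z) = (\<Sum>i<n. es ! 1 * (w $ i)\<^sup>2)"
      unfolding form(2)[OF z] w_def by (simp add: sum_distrib_left)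
    \<comment> \<open>The term with index 0 vanishes by the choice of \<open>z\<close>; from index 1
      on, sortedness gives \<open>es ! 1 \<le> es ! i\<close>.\<close>
    also have "\<dots> \<le> (\<Sum>i<n. es ! i * (w $ i)\<^sup>2)"
    proof (rule sum_mono)
      fix i assume "i \<in> {..<n}"
      then show "es ! 1 * (w $ i)\<^sup>2 \<le> es ! i * (w $ i)\<^sup>2"
        using w0 sorted len by (cases "i = 0") (auto intro!: mult_right_mono sorted_nth_mono)
    qed
    also have "\<dots> = z \<bullet> (M *\<^sub>v z)"
      unfolding form(1)[OF z] w_def ..
    also have "\<dots> \<le> c * (z \<bullet> z)" by (rule le[OF z_def])
    finally show "nth_eigenvalue 2 M \<le> c" using zz ev by simp
  qed
qed

lemma scalar_prod_mult_mat_vec_sum: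
  assumes "M \<in> carrier_mat n n" "z \<in> carrier_vec n"
  shows "z \<bullet> (M *\<^sub>v z) = (\<Sum>i<n. \<Sum>j<n. M $$ (i, j) * z $ i * (z $ j :: 'a :: comm_semiring_0))"
  using assms
  by (auto simp: scalar_prod_def atLeast0LessThan sum_distrib_left ac_simps intro!: sum.cong)

section \<open>Quadratic forms of weighted graphs\<close>

lemma H_mat_carrier:
  assumes "A \<in> carrier_mat n n" "U \<in> carrier_mat n n"
  shows "H_mat A U \<in> carrier_mat n n"
  using assms by (auto simp: H_mat_def deg_inv_sqrt_def mat_diag_def)

lemma H_mat_index:
  assumes A: "A \<in> carrier_mat n n" and U: "U \<in> carrier_mat n n" and ij: "i < n" "j < n"
  shows "H_mat A U $$ (i, j) =
    (if i = j then 1 else 0) - (A $$ (i, j) - U $$ (i, j)) / (sqrt (deg A i) * sqrt (deg A j))"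
proof -
  let ?d = "\<lambda>j. 1 / sqrt (deg A j)"
  have B: "A - U \<in> carrier_mat n n" using U by (rule minus_carrier_mat)
  have dA: "dim_row A = n" using A by simp
  have "mat_diag n ?d * (A - U) * mat_diag n ?d = mat n n (\<lambda>(i, j). ?d i * (A - U) $$ (i, j) * ?d j)"
    by (subst mat_diag_mult_left[OF B], subst mat_diag_mult_right[of _ n n]) auto
  then show ?thesis
    unfolding H_mat_def deg_inv_sqrt_def dA using A U ij by simp
qed

lemma H_mat_symmetric:
  assumes A: "A \<in> carrier_mat n n" and U: "U \<in> carrier_mat n n"
    and "transpose_mat A = A" and "transpose_mat U = U"
  shows "transpose_mat (H_mat A U) = H_mat A U"
proof -
  have "A $$ (i, j) = A $$ (j, i)" "U $$ (i, j) = U $$ (j, i)" if "i < n" "j < n" for i j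
    using that assms by (metis carrier_matD index_transpose_mat(1))+
  then show ?thesis
    using H_mat_carrier[OF A U]
    by (intro eq_matI) (auto simp: H_mat_index[OF A U] mult.commute)
qed

text \<open>Conjugating a diagonal matrix by \<open>deg_inv_sqrt A\<close> keeps it diagonal and
  divides its entries by the degrees, so the potential only adds a weighted sum of squares.\<close>

lemma quadratic_form_H_mat_potential:
  assumes A: "A \<in> carrier_mat n n" and pos: "\<And>j. j < n \<Longrightarrow> deg A j > 0"
    and z: "z \<in> carrier_vec n"
  shows "z \<bullet> (H_mat A (mat_diag n u) *\<^sub>v z) =
    z \<bullet> (H_mat A (0\<^sub>m n n) *\<^sub>v z) + (\<Sum>j<n. u j / deg A j * (z $ j)\<^sup>2)"
proof -
  have U: "mat_diag n u \<in> carrier_mat n n" and Z: "0\<^sub>m n n \<in> carrier_mat n n" by simp_all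
  have entry: "H_mat A (mat_diag n u) $$ (i, j) =
      H_mat A (0\<^sub>m n n) $$ (i, j) + (if i = j then u i / deg A i else 0)"
    if "i < n" "j < n" for i j
  proof -
    have "mat_diag n u $$ (i, j) = (if i = j then u i else 0)"
      using that by (simp add: mat_diag_def)
    then show ?thesis
      using that pos[of i]
      by (auto simp: H_mat_index[OF A U] H_mat_index[OF A Z] diff_divide_distrib)
  qed
  have "z \<bullet> (H_mat A (mat_diag n u) *\<^sub>v z) =
      (\<Sum>i<n. \<Sum>j<n. H_mat A (0\<^sub>m n n) $$ (i, j) * z $ i * z $ j
        + (if i = j then u i / deg A i * z $ i * z $ j else 0))"
    unfolding scalar_prod_mult_mat_vec_sum[OF H_mat_carrier[OF A U] z]
    by (intro sum.cong refl) (auto simp: entry algebra_simps)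
  also have "\<dots> = z \<bullet> (H_mat A (0\<^sub>m n n) *\<^sub>v z) + (\<Sum>j<n. u j / deg A j * (z $ j)\<^sup>2)"
    unfolding scalar_prod_mult_mat_vec_sum[OF H_mat_carrier[OF A Z] z]
    by (simp add: sum.distrib power2_eq_square mult.assoc)
  finally show ?thesis .
qed

text \<open>The substitution by square roots of degrees cancels the normalization. Expanding
  \<open>(f i - f j)\<^sup>2\<close> and summing over ordered pairs gives each degree term once from
  either index, whence the division by 2; loops contribute nothing.\<close>

lemma quadratic_form_H_mat_Dirichlet:
  assumes A: "A \<in> carrier_mat n n" and sym: "transpose_mat A = A"
    and pos: "\<And>j. j < n \<Longrightarrow> deg A j > 0"
    and z: "z = vec n (\<lambda>i. sqrt (deg A i) * f i)"
  shows "z \<bullet> (H_mat A (0\<^sub>m n n) *\<^sub>v z) = (\<Sum>i<n. \<Sum>j<n. A $$ (i, j) * (f i - f j)\<^sup>2) / 2"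
proof -
  have Z: "0\<^sub>m n n \<in> carrier_mat n n" by simp
  have symij: "A $$ (i, j) = A $$ (j, i)" if "i < n" "j < n" for i j
    using that A sym by (metis carrier_matD index_transpose_mat(1))
  have zc: "z \<in> carrier_vec n" by (simp add: z)
  have deg: "deg A j = (\<Sum>i<n. A $$ (i, j))" for j
    using A by (simp add: deg_def vertices_def atLeast0LessThan)
  \<comment> \<open>The degree term is written in two ways, with \<open>f\<close> at the column
    index and, by symmetry of \<open>A\<close>, at the row index. Their average completes the
    squares below.\<close>
  have degf: "(\<Sum>j<n. deg A j * (f j)\<^sup>2) = (\<Sum>i<n. \<Sum>j<n. A $$ (i, j) * (f j)\<^sup>2)"
    unfolding deg sum_distrib_right by (rule sum.swap)
  have degf': "(\<Sum>j<n. deg A j * (f j)\<^sup>2) = (\<Sum>i<n. \<Sum>j<n. A $$ (i, j) * (f i)\<^sup>2)"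
    unfolding deg sum_distrib_right by (intro sum.cong refl) (simp add: symij)
  have entry: "H_mat A (0\<^sub>m n n) $$ (i, j) * z $ i * z $ j =
      (if i = j then deg A i * (f i)\<^sup>2 else 0) - A $$ (i, j) * f i * f j"
    if "i < n" "j < n" for i j
  proof -
    have *: "sqrt (deg A i) * sqrt (deg A i) = deg A i" "sqrt (deg A i) \<noteq> 0" "sqrt (deg A j) \<noteq> 0"
      using pos[of i] pos[of j] that by auto
    have "A $$ (i, j) / (sqrt (deg A i) * sqrt (deg A j)) * (sqrt (deg A i) * f i) * (sqrt (deg A j) * f j)
        = A $$ (i, j) * f i * f j"
      using * by (simp add: field_simps)
    moreover have "sqrt (deg A i) * f i * (sqrt (deg A i) * f i) = deg A i * (f i)\<^sup>2"
      using *(1) by (metis mult.assoc mult.left_commute power2_eq_square)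
    ultimately show ?thesis
      using that by (auto simp: z H_mat_index[OF A Z] left_diff_distrib)
  qed
  have "z \<bullet> (H_mat A (0\<^sub>m n n) *\<^sub>v z) =
      (\<Sum>i<n. \<Sum>j<n. (if i = j then deg A i * (f i)\<^sup>2 else 0) - A $$ (i, j) * f i * f j)"
    unfolding scalar_prod_mult_mat_vec_sum[OF H_mat_carrier[OF A Z] zc]
    by (intro sum.cong refl) (simp only: entry lessThan_iff)
  also have "\<dots> = (\<Sum>j<n. deg A j * (f j)\<^sup>2) - (\<Sum>i<n. \<Sum>j<n. A $$ (i, j) * f i * f j)"
    by (simp add: sum_subtractf)
  also have "\<dots> = ((\<Sum>i<n. \<Sum>j<n. A $$ (i, j) * (f i)\<^sup>2) + (\<Sum>i<n. \<Sum>j<n. A $$ (i, j) * (f j)\<^sup>2)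
      - 2 * (\<Sum>i<n. \<Sum>j<n. A $$ (i, j) * f i * f j)) / 2"
    using degf degf' by simp
  also have "\<dots> = (\<Sum>i<n. \<Sum>j<n. A $$ (i, j) * (f i - f j)\<^sup>2) / 2"
    by (simp add: sum_distrib_left sum.distrib[symmetric] sum_subtractf[symmetric]
        power2_eq_square algebra_simps)
  finally show ?thesis .
qed

section \<open>Cuts and two-valued test functions\<close>

lemma edge_weight_commute:
  assumes A: "A \<in> carrier_mat n n" and sym: "transpose_mat A = A"
    and "X \<subseteq> {..<n}" "Y \<subseteq> {..<n}"
  shows "edge_weight A X Y = edge_weight A Y X"
proof -
  have "A $$ (i, j) = A $$ (j, i)" if "i \<in> X" "j \<in> Y" for i j
    using that assms by (metis carrier_matD index_transpose_mat(1) lessThan_iff subsetD)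
  then show ?thesis
    unfolding edge_weight_def by (subst sum.swap) (auto intro!: sum.cong)
qed

text \<open>Only pairs separated by the cut contribute. Each is met in both orders, and the two
  directions weigh the same by symmetry, hence the factor 2.\<close>

lemma Dirichlet_form_two_valued:
  assumes A: "A \<in> carrier_mat n n" and sym: "transpose_mat A = A" and X: "X \<subseteq> {..<n}"
    and f: "f = (\<lambda>i. if i \<in> X then a else b)"
  shows "(\<Sum>i<n. \<Sum>j<n. A $$ (i, j) * (f i - f j)\<^sup>2) = 2 * (a - b)\<^sup>2 * edge_weight A X ({..<n} - X)"
proof -
  let ?Y = "{..<n} - X"
  have split: "(\<Sum>i<n. g i) = (\<Sum>i\<in>X. g i) + (\<Sum>i\<in>?Y. g i)" for g :: "nat \<Rightarrow> real"
    using X by (metis add.commute finite_lessThan sum.subset_diff)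
  have "(\<Sum>i<n. \<Sum>j<n. A $$ (i, j) * (f i - f j)\<^sup>2)
      = (a - b)\<^sup>2 * edge_weight A X ?Y + (a - b)\<^sup>2 * edge_weight A ?Y X"
    unfolding split edge_weight_def sum_distrib_left
    by (simp add: f power2_commute[of b a] mult.commute)
  then show ?thesis
    using edge_weight_commute[OF A sym X, of ?Y] by simp
qed

text \<open>A whole test plane is supplied to \<open>second_eigenvalue_le_iff\<close>, so no
  orthogonality to the first eigenvector has to be arranged. Its vectors are constant on each side
  of the cut up to the degree weights.\<close>

lemma second_eigenvalue_le_cut_ratio:
  assumes n: "n \<ge> 2" and A: "A \<in> carrier_mat n n" and sym: "transpose_mat A = A"
    and nonneg: "\<And>i j. i < n \<Longrightarrow> j < n \<Longrightarrow> A $$ (i, j) \<ge> 0"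
    and pos: "\<And>j. j < n \<Longrightarrow> deg A j > 0"
    and X: "X \<noteq> {}" "X \<subset> {..<n}"
  shows "nth_eigenvalue 2 (H_mat A (0\<^sub>m n n)) \<le>
    2 * (edge_weight A X ({..<n} - X) / min (vol A X) (vol A ({..<n} - X)))"
proof -
  let ?Y = "{..<n} - X" and ?H = "H_mat A (0\<^sub>m n n)"
  define E where "E = edge_weight A X ?Y"
  define m where "m = min (vol A X) (vol A ?Y)"
  have finX: "finite X" using X finite_subset by blast
  have E: "E \<ge> 0" unfolding E_def edge_weight_def using X by (intro sum_nonneg nonneg) auto
  \<comment> \<open>Both sides of the cut are nonempty and all degrees are positive, so the
    denominator \<open>m\<close> may be divided by.\<close>
  have "vol A X > 0" "vol A ?Y > 0"
    unfolding vol_def using X finX by (auto intro!: sum_pos pos)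
  then have m: "m > 0" by (simp add: m_def)
  have Z: "0\<^sub>m n n \<in> carrier_mat n n" by simp
  have H: "?H \<in> carrier_mat n n" by (rule H_mat_carrier[OF A Z])
  have HT: "transpose_mat ?H = ?H"
    by (rule H_mat_symmetric[OF A Z sym]) simp
  define x where "x = vec n (\<lambda>i. if i \<in> X then sqrt (deg A i) else 0)"
  define y where "y = vec n (\<lambda>i. if i \<in> X then 0 else sqrt (deg A i))"
  have z: "a \<cdot>\<^sub>v x + b \<cdot>\<^sub>v y = vec n (\<lambda>i. sqrt (deg A i) * (if i \<in> X then a else b))" for a b
    by (intro eq_vecI) (auto simp: x_def y_def)
  show ?thesis
    unfolding second_eigenvalue_le_iff[OF H HT n] Let_def E_def[symmetric] m_def[symmetric]
  proof (intro bexI conjI allI impI)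
    fix a b assume 0: "a \<cdot>\<^sub>v x + b \<cdot>\<^sub>v y = 0\<^sub>v n"
    have val: "sqrt (deg A i) * (if i \<in> X then a else b) = 0" if "i < n" for i
      using arg_cong[OF 0, of "\<lambda>w. w $ i"] that unfolding z by simp
    \<comment> \<open>One vertex on each side of the cut isolates \<open>a\<close> and
      \<open>b\<close>, since the degree weights are nonzero.\<close>
    obtain i j where "i \<in> X" "j < n" "j \<notin> X" using X by blast
    then show "a = 0" "b = 0" using val[of i] val[of j] pos[of i] pos[of j] X by auto
  next
    fix a b
    let ?z = "a \<cdot>\<^sub>v x + b \<cdot>\<^sub>v y"
    let ?f = "\<lambda>i. if i \<in> X then a else b"
    have "?z \<bullet> (?H *\<^sub>v ?z) = (a - b)\<^sup>2 * E"
      using quadratic_form_H_mat_Dirichlet[OF A sym pos z[of a b]]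
        Dirichlet_form_two_valued[OF A sym psubset_imp_subset[OF X(2)] refl, of a b]
      by (simp add: E_def)
    \<comment> \<open>This is \<open>- 2 * a * b \<le> a\<^sup>2 + b\<^sup>2\<close>; it is the
      source of the factor 2 in the Cheeger bound.\<close>
    also have "\<dots> \<le> (2 * (a\<^sup>2 + b\<^sup>2)) * E"
      using E sum_squares_bound[of a "- b"] by (intro mult_right_mono) (auto simp: power2_diff)
    also have "\<dots> = 2 * (E / m) * (a\<^sup>2 * m + b\<^sup>2 * m)"
      using m by (simp add: field_simps)
    \<comment> \<open>\<open>m\<close> is at most either volume, which is where the minimum in the
      Cheeger ratio enters.\<close>
    also have "\<dots> \<le> 2 * (E / m) * (a\<^sup>2 * vol A X + b\<^sup>2 * vol A ?Y)"
      using E m by (intro mult_left_mono add_mono) (auto simp: m_def)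
    also have "a\<^sup>2 * vol A X + b\<^sup>2 * vol A ?Y = ?z \<bullet> ?z"
    proof -
      have "?z \<bullet> ?z = (\<Sum>i<n. deg A i * (?f i)\<^sup>2)"
        unfolding z scalar_prod_def atLeast0LessThan dim_vec
      proof (intro sum.cong refl)
        fix i assume "i \<in> {..<n}"
        then have "(sqrt (deg A i) * ?f i)\<^sup>2 = deg A i * (?f i)\<^sup>2"
          using pos[of i] by (simp add: power_mult_distrib)
        then show "vec n (\<lambda>i. sqrt (deg A i) * ?f i) $ i * vec n (\<lambda>i. sqrt (deg A i) * ?f i) $ i
            = deg A i * (?f i)\<^sup>2"
          using \<open>i \<in> {..<n}\<close> by (simp add: power2_eq_square)
      qed
      also have "\<dots> = (\<Sum>i\<in>?Y. deg A i * (?f i)\<^sup>2) + (\<Sum>i\<in>X. deg A i * (?f i)\<^sup>2)"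
        using X by (intro sum.subset_diff) auto
      also have "\<dots> = a\<^sup>2 * vol A X + b\<^sup>2 * vol A ?Y"
        by (simp add: vol_def sum_distrib_left sum_distrib_right mult.commute)
      finally show ?thesis ..
    qed
    finally show "?z \<bullet> (?H *\<^sub>v ?z) \<le> 2 * (E / m) * (?z \<bullet> ?z)" .
  qed (auto simp: x_def y_def)
qed

section \<open>Comparison with the potential-free operator and the Cheeger bound\<close>

theorem mainTheorem7:
  fixes n :: nat and A U :: "real mat" and \<sigma> :: "real vec"
  assumes "n \<ge> 2"
    and "A \<in> carrier_mat n n"
    and "transpose_mat A = A"
    and "\<And>i j. i < n \<Longrightarrow> j < n \<Longrightarrow> A $$ (i, j) \<ge> 0"
    and "connected_graph A"
    and "\<And>j. j < n \<Longrightarrow> deg A j > 0"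
    and "\<sigma> \<in> carrier_vec n"
    and "\<And>j. j < n \<Longrightarrow> \<sigma> $ j \<ge> 0"
    and "U = mat_diag n (\<lambda>j. \<sigma> $ j)"
  shows "nth_eigenvalue 2 (H_mat A U) \<le> nth_eigenvalue 2 (H_mat A (0\<^sub>m n n)) + surface_area A \<sigma>
    \<and> nth_eigenvalue 2 (H_mat A (0\<^sub>m n n)) + surface_area A \<sigma> \<le> 2 * cheeger A + surface_area A \<sigma>"
proof
  note n = assms(1) and A = assms(2) and sym = assms(3) and pos = assms(6) and U = assms(9)
  have Z: "0\<^sub>m n n \<in> carrier_mat n n" and Uc: "U \<in> carrier_mat n n" by (simp_all add: U)
  have HT: "transpose_mat (H_mat A (0\<^sub>m n n)) = H_mat A (0\<^sub>m n n)"
    by (rule H_mat_symmetric[OF A Z sym]) simp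
  have HUT: "transpose_mat (H_mat A U) = H_mat A U"
    by (rule H_mat_symmetric[OF A Uc sym]) (auto simp: U mat_diag_def)
  have V: "vertices A = {..<n}" using A by (simp add: vertices_def atLeast0LessThan)
  let ?S = "surface_area A \<sigma>"
  have bound: "z \<bullet> (H_mat A U *\<^sub>v z) \<le> z \<bullet> (H_mat A (0\<^sub>m n n) *\<^sub>v z) + ?S * (z \<bullet> z)"
    if z: "z \<in> carrier_vec n" for z
  proof -
    \<comment> \<open>A single summand is bounded by the whole sum because all summands are
      nonnegative.\<close>
    have "\<sigma> $ j / deg A j \<le> ?S" if "j < n" for j
      unfolding surface_area_def V using that assms(8) less_imp_le[OF pos]
      by (intro member_le_sum) auto
    then have "(\<Sum>j<n. \<sigma> $ j / deg A j * (z $ j)\<^sup>2) \<le> (\<Sum>j<n. ?S * (z $ j)\<^sup>2)"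
      by (intro sum_mono mult_right_mono) auto
    also have "\<dots> = ?S * (z \<bullet> z)"
      using z by (simp add: scalar_prod_def atLeast0LessThan power2_eq_square sum_distrib_left)
    finally show ?thesis
      using quadratic_form_H_mat_potential[OF A pos z, of "\<lambda>j. \<sigma> $ j"] by (simp add: U)
  qed
  let ?l = "nth_eigenvalue 2 (H_mat A (0\<^sub>m n n))"
  \<comment> \<open>The characterization with \<open>c = ?l\<close> holds trivially on its left side
    and returns a plane that is optimal for the operator without potential.\<close>
  obtain x y where xy: "x \<in> carrier_vec n" "y \<in> carrier_vec n"
    and indep: "\<forall>a b. a \<cdot>\<^sub>v x + b \<cdot>\<^sub>v y = 0\<^sub>v n \<longrightarrow> a = 0 \<and> b = 0"
    and le: "\<And>a b z. z = a \<cdot>\<^sub>v x + b \<cdot>\<^sub>v y \<Longrightarrow> z \<bullet> (H_mat A (0\<^sub>m n n) *\<^sub>v z) \<le> ?l * (z \<bullet> z)"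
    using second_eigenvalue_le_iff[OF H_mat_carrier[OF A Z] HT n, of ?l]
    by (auto simp: Let_def)
  show "nth_eigenvalue 2 (H_mat A U) \<le> ?l + ?S"
    unfolding second_eigenvalue_le_iff[OF H_mat_carrier[OF A Uc] HUT n] Let_def
  proof (intro bexI conjI)
    show "\<forall>a b. (a \<cdot>\<^sub>v x + b \<cdot>\<^sub>v y) \<bullet> (H_mat A U *\<^sub>v (a \<cdot>\<^sub>v x + b \<cdot>\<^sub>v y))
        \<le> (?l + ?S) * ((a \<cdot>\<^sub>v x + b \<cdot>\<^sub>v y) \<bullet> (a \<cdot>\<^sub>v x + b \<cdot>\<^sub>v y))"
    proof (intro allI)
      fix a b
      define z where "z = a \<cdot>\<^sub>v x + b \<cdot>\<^sub>v y"
      have "z \<in> carrier_vec n" using xy by (simp add: z_def)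
      from bound[OF this] le[OF z_def]
      have "z \<bullet> (H_mat A U *\<^sub>v z) \<le> (?l + ?S) * (z \<bullet> z)"
        by (simp add: distrib_right)
      then show "(a \<cdot>\<^sub>v x + b \<cdot>\<^sub>v y) \<bullet> (H_mat A U *\<^sub>v (a \<cdot>\<^sub>v x + b \<cdot>\<^sub>v y))
          \<le> (?l + ?S) * ((a \<cdot>\<^sub>v x + b \<cdot>\<^sub>v y) \<bullet> (a \<cdot>\<^sub>v x + b \<cdot>\<^sub>v y))"
        by (simp only: z_def)
    qed
  qed (use xy indep in blast)+
  let ?r = "\<lambda>X. edge_weight A X ({..<n} - X) / min (vol A X) (vol A ({..<n} - X))"
  let ?C = "{?r X |X. X \<noteq> {} \<and> X \<subset> {..<n}}"
  \<comment> \<open>The minimum defining \<open>cheeger A\<close> is attained: there are finitely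
    many cuts, and \<open>n \<ge> 2\<close> makes \<open>{0}\<close> an admissible one. The bound
    for a single cut can then be applied to a minimizing set.\<close>
  have "?C = ?r ` {X. X \<noteq> {} \<and> X \<subset> {..<n}}" by blast
  moreover have "finite {X. X \<noteq> {} \<and> X \<subset> {..<n}}"
    by (rule finite_subset[of _ "Pow {..<n}"]) auto
  ultimately have "finite ?C" by simp
  moreover have "1 \<in> {..<n} - {0}" "{0} \<subseteq> {..<n}" using n by auto
  then have "{0} \<subset> {..<n}" by blast
  then have "?r {0} \<in> ?C" by (intro CollectI exI[of _ "{0}"]) simp
  then have "?C \<noteq> {}" by (metis empty_iff)
  ultimately have "cheeger A \<in> ?C" unfolding cheeger_def V by (rule Min_in)
  then obtain X where "X \<noteq> {}" "X \<subset> {..<n}" "cheeger A = ?r X" by blast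
  then show "?l + ?S \<le> 2 * cheeger A + ?S"
    using second_eigenvalue_le_cut_ratio[OF n A sym assms(4) pos] by simp
qed

end
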